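(* Let $Q\in\mathbb{R}^{\ell\times\ell}$ be a (not necessarily symmetric) matrix with $Q^T+Q\succ 0$, let $G\in\mathbb{R}^{\ell\times\ell}$ be a symmetric matrix with $$0\prec G\prec Q^T+Q ,$$ and put $\Delta:=Q^T+Q-G$. Then $\Delta\succ 0$, and for matrices $H,M\in\mathbb{R}^{\ell\times\ell}$, $$M^THM=\Delta\ \text{ and }\ HM=Q \quad\Longleftrightarrow\quad M=Q^{-T}\Delta\ \text{ and }\ H=Q\Delta^{-1}Q^T .$$ In particular $H$ and $M$ are uniquely determined by $Q$ and $G$. Moreover, with $M=Q^{-T}\Delta$ and $H=Q\Delta^{-1}Q^T$, the matrix $M$ is nonsingular and the following hold: $H\succ 0$, $HM=Q$, and $Q^T+Q-M^THM=G\succ 0$.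
   Context: For real square matrices of the same size, $A\succ 0$ means that $A$ is symmetric and positive definite, and $A\prec B$ means that $B-A\succ 0$. $Q^{-T}$ denotes $(Q^T)^{-1}$. *)

theory Defs
  imports "HOL-Analysis.Analysis"
begin

text \<open>Symmetry is part of positive definiteness: quadratic forms alone do not detect the
  skew-symmetric part of a real matrix.\<close>

definition posdef :: "real^'n^'n \<Rightarrow> bool" where
  "posdef A \<longleftrightarrow> transpose A = A \<and> (\<forall>x. x \<noteq> 0 \<longrightarrow> 0 < x \<bullet> (A *v x))"

definition mat_prec :: "real^'n^'n \<Rightarrow> real^'n^'n \<Rightarrow> bool"  (infix "\<prec>" 50) where
  "A \<prec> B \<longleftrightarrow> posdef (B - A)"

end

theory Submission
  imports Defs
begin

text \<open>
  The system \<open>M\<^sup>T H M = \<Delta>\<close>, \<open>H M = Q\<close> looks quadratic in \<open>M\<close>, but the second equation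
  linearises the first: it becomes \<open>M\<^sup>T Q = \<Delta>\<close>, which by symmetry of \<open>\<Delta>\<close> is
  \<open>Q\<^sup>T M = \<Delta>\<close>. With \<open>Q\<close> and \<open>\<Delta>\<close> nonsingular this determines \<open>M\<close>, shows that
  \<open>M\<close> is nonsingular with inverse \<open>\<Delta>\<^sup>-\<^sup>1 Q\<^sup>T\<close>, and then \<open>H M = Q\<close> determines \<open>H\<close>
  (lemma \<open>factorization_iff\<close>).

  Positivity enters only through nonsingularity and congruence. A matrix whose quadratic form
  vanishes only at \<open>0\<close> has trivial kernel; this covers \<open>\<Delta>\<close> and also the nonsymmetric \<open>Q\<close>,
  whose quadratic form is half that of \<open>Q\<^sup>T + Q\<close>. Finally
  \<open>H = N\<^sup>T \<Delta> N\<close> with the nonsingular matrix \<open>N = \<Delta>\<^sup>-\<^sup>1 Q\<^sup>T\<close>, so \<open>H\<close> inherits positive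
  definiteness from \<open>\<Delta>\<close> (lemma \<open>posdef_congruence\<close>).
\<close>

lemma matrix_inv_cancel:
  fixes A :: "real^'n^'n"
  assumes "invertible A"
  shows "A ** matrix_inv A = mat 1" "matrix_inv A ** A = mat 1"
  using someI_ex[OF assms[unfolded invertible_def]] by (auto simp: matrix_inv_def)

lemma matrix_mul_inv_cancel:
  fixes A B :: "real^'n^'n"
  assumes "invertible A"
  shows "B ** A ** matrix_inv A = B" "B ** matrix_inv A ** A = B"
    "A ** (matrix_inv A ** B) = B" "matrix_inv A ** (A ** B) = B"
  using matrix_inv_cancel[OF assms]
  by (simp_all add: matrix_mul_assoc) (simp_all add: matrix_mul_assoc[symmetric])

lemma invertible_matrix_inv:
  fixes A :: "real^'n^'n"
  assumes "invertible A"
  shows "invertible (matrix_inv A)"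
  using matrix_inv_cancel[OF assms] by (auto simp: invertible_def)

lemma transpose_matrix_inv:
  fixes A :: "real^'n^'n"
  assumes "invertible A"
  shows "transpose (matrix_inv A) = matrix_inv (transpose A)"
proof -
  have inv: "invertible (transpose A)"
    using assms by (rule transpose_invertible)
  have "transpose A ** transpose (matrix_inv A) = mat 1"
    by (metis matrix_transpose_mul matrix_inv_cancel(2)[OF assms] transpose_mat)
  then show ?thesis
    by (metis inv matrix_mul_inv_cancel(4) matrix_mul_rid)
qed

lemma invertible_if_quadratic_form_pos:
  fixes A :: "real^'n^'n"
  assumes "\<And>x. x \<noteq> 0 \<Longrightarrow> 0 < x \<bullet> (A *v x)"
  shows "invertible A"
proof -
  have "x = 0" if "A *v x = 0" for x
    using assms[of x] that by force
  then show ?thesis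
    using invertible_left_inverse matrix_left_invertible_ker by blast
qed

lemma posdef_invertible: "posdef A \<Longrightarrow> invertible A"
  by (rule invertible_if_quadratic_form_pos) (simp add: posdef_def)

text \<open>The skew-symmetric part of \<open>Q\<close> does not contribute to its quadratic form.\<close>

lemma invertible_if_posdef_symmetric_part:
  fixes Q :: "real^'n^'n"
  assumes "posdef (transpose Q + Q)"
  shows "invertible Q"
proof (rule invertible_if_quadratic_form_pos)
  fix x :: "real^'n"
  assume "x \<noteq> 0"
  then have "0 < x \<bullet> ((transpose Q + Q) *v x)"
    using assms by (simp add: posdef_def)
  also have "\<dots> = x \<bullet> (transpose Q *v x) + x \<bullet> (Q *v x)"
    by (simp only: matrix_vector_mult_add_rdistrib inner_add_right)
  also have "x \<bullet> (transpose Q *v x) = x \<bullet> (Q *v x)"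
    by (metis dot_lmul_matrix inner_commute transpose_matrix_vector)
  finally show "0 < x \<bullet> (Q *v x)"
    by simp
qed

lemma posdef_congruence:
  fixes A P :: "real^'n^'n"
  assumes A: "posdef A" and P: "invertible P"
  shows "posdef (transpose P ** A ** P)"
  unfolding posdef_def
proof (intro conjI allI impI)
  show "transpose (transpose P ** A ** P) = transpose P ** A ** P"
    using A by (simp add: posdef_def matrix_transpose_mul matrix_mul_assoc)
next
  fix x :: "real^'n"
  assume "x \<noteq> 0"
  then have "P *v x \<noteq> 0"
    using P invertible_left_inverse matrix_left_invertible_ker by blast
  then have "0 < (P *v x) \<bullet> (A *v (P *v x))"
    using A by (simp add: posdef_def)
  also have "\<dots> = x \<bullet> (transpose P *v (A *v (P *v x)))"
    by (metis dot_lmul_matrix transpose_matrix_vector transpose_transpose)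
  also have "\<dots> = x \<bullet> ((transpose P ** A ** P) *v x)"
    by (simp only: matrix_vector_mul_assoc matrix_mul_assoc)
  finally show "0 < x \<bullet> ((transpose P ** A ** P) *v x)" .
qed

text \<open>Substituting \<open>H M = Q\<close> into \<open>M\<^sup>T H M = D\<close> and transposing leaves the linear equation
  \<open>Q\<^sup>T M = D\<close>; both directions go through this equation.\<close>

lemma factorization_iff:
  fixes Q D H M :: "real^'n^'n"
  assumes Q: "invertible Q" and D: "invertible D" and sym: "transpose D = D"
  shows "transpose M ** H ** M = D \<and> H ** M = Q \<longleftrightarrow>
    M = matrix_inv (transpose Q) ** D \<and> H = Q ** matrix_inv D ** transpose Q"
    (is "?lhs \<longleftrightarrow> ?rhs")
proof
  note QT = transpose_invertible[OF Q]
  have linear: "transpose M ** H ** M = D \<longleftrightarrow> transpose Q ** M = D" if "H ** M = Q"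
    using that sym by (metis matrix_mul_assoc matrix_transpose_mul transpose_transpose)
  {
    assume ?lhs
    then have HM: "H ** M = Q" and QM: "transpose Q ** M = D"
      using linear by auto
    from QM have M: "M = matrix_inv (transpose Q) ** D"
      using matrix_mul_inv_cancel(4)[OF QT] by metis
    then have "M ** (matrix_inv D ** transpose Q) = mat 1"
      using QT D by (simp add: matrix_mul_assoc matrix_mul_inv_cancel matrix_inv_cancel)
    then have "H = Q ** matrix_inv D ** transpose Q"
      using HM by (metis matrix_mul_assoc matrix_mul_rid)
    with M show ?rhs by simp
  next
    assume ?rhs
    then have HM: "H ** M = Q" and "transpose Q ** M = D"
      using QT D by (simp_all add: matrix_mul_assoc[symmetric] matrix_mul_inv_cancel
          matrix_inv_cancel)
    then show ?lhs
      using linear by simp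
  }
qed

theorem mainTheorem2:
  fixes Q G \<Delta> :: "real^'l^'l"
  assumes Q_pos: "posdef (transpose Q + Q)"
    and G_sym: "transpose G = G"
    and G_pos: "0 \<prec> G"
    and G_less: "G \<prec> transpose Q + Q"
    and Delta: "\<Delta> = transpose Q + Q - G"
  shows "posdef \<Delta> \<and> invertible \<Delta> \<and> invertible (transpose Q) \<and>
    (\<forall>H M :: real^'l^'l.
      transpose M ** H ** M = \<Delta> \<and> H ** M = Q \<longleftrightarrow>
      M = matrix_inv (transpose Q) ** \<Delta> \<and> H = Q ** matrix_inv \<Delta> ** transpose Q) \<and>
    (\<exists>!p :: (real^'l^'l) \<times> (real^'l^'l). case p of (H, M) \<Rightarrow>
      transpose M ** H ** M = \<Delta> \<and> H ** M = Q) \<and>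
    (\<forall>H M :: real^'l^'l.
      M = matrix_inv (transpose Q) ** \<Delta> \<and> H = Q ** matrix_inv \<Delta> ** transpose Q \<longrightarrow>
      invertible M \<and> posdef H \<and> H ** M = Q \<and>
      transpose Q + Q - transpose M ** H ** M = G \<and> posdef G)"
proof -
  have D: "posdef \<Delta>"
    using G_less by (simp add: mat_prec_def Delta)
  have G: "posdef G"
    using G_pos by (simp add: mat_prec_def)
  have Dinv: "invertible \<Delta>" and Dsym: "transpose \<Delta> = \<Delta>"
    using D by (simp_all add: posdef_invertible posdef_def)
  have Qinv: "invertible Q"
    using Q_pos by (rule invertible_if_posdef_symmetric_part)
  note QTinv = transpose_invertible[OF Qinv]
  note iff = factorization_iff[OF Qinv Dinv Dsym]
  let ?N = "matrix_inv \<Delta> ** transpose Q"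
  have "transpose ?N = Q ** matrix_inv \<Delta>"
    by (simp add: matrix_transpose_mul transpose_matrix_inv[OF Dinv] Dsym)
  then have "Q ** matrix_inv \<Delta> ** transpose Q = transpose ?N ** \<Delta> ** ?N"
    by (simp add: matrix_mul_assoc matrix_mul_inv_cancel[OF Dinv])
  moreover have "invertible ?N"
    by (simp add: invertible_mult invertible_matrix_inv Dinv QTinv)
  ultimately have Hpos: "posdef (Q ** matrix_inv \<Delta> ** transpose Q)"
    using posdef_congruence[OF D] by metis
  have Minv: "invertible (matrix_inv (transpose Q) ** \<Delta>)"
    by (simp add: invertible_mult invertible_matrix_inv Dinv QTinv)
  have unique: "\<exists>!p :: (real^'l^'l) \<times> (real^'l^'l). case p of (H, M) \<Rightarrow>
      transpose M ** H ** M = \<Delta> \<and> H ** M = Q"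
    unfolding iff by auto
  have props: "invertible M \<and> posdef H \<and> H ** M = Q \<and>
      transpose Q + Q - transpose M ** H ** M = G \<and> posdef G"
    if "M = matrix_inv (transpose Q) ** \<Delta> \<and> H = Q ** matrix_inv \<Delta> ** transpose Q" for H M
  proof -
    have "transpose M ** H ** M = \<Delta>" "H ** M = Q"
      using that iff by blast+
    then show ?thesis
      using that Minv Hpos G by (simp add: Delta)
  qed
  show ?thesis
    using D Dinv QTinv iff unique props by blast
qed

end
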